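(* Let $m \geq 3$ be an integer and let $\mathcal{A}(m) = \langle x, y \mid w_m(x,y) = w_m(y,x) \rangle$ be the 2-generated Artin group, where $w_m(u,v) = (uv)^n$ if $m = 2n$ and $w_m(u,v) = (uv)^n u$ if $m = 2n+1$. Then $\mathcal{A}(m)$ is a split extension of a free group of finite rank and a cyclic group generated by a virtually inner automorphism; that is, $\mathcal{A}(m)$ is isomorphic to a semi-direct product $F \rtimes \langle t \rangle$, where $F$ is a free group of finite rank, $\langle t \rangle$ is a cyclic group, and conjugation by $t$ induces on $F$ a virtually inner automorphism $\varphi$, $t^{-1} f t = \varphi(f)$ for all $f \in F$.
   Context: An automorphism $\varphi$ of a free group $F$ is called virtually inner if $\varphi^k$ is an inner automorphism of $F$ for some positive integer $k$. *)

theory Defs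
  imports "HOL-Algebra.Algebra"
begin

section \<open>Free groups\<close>

text \<open>
  A letter \<^term>\<open>(x, True)\<close> stands for the generator \<^term>\<open>x\<close>, and \<^term>\<open>(x, False)\<close> for its
  inverse. The free group on \<^term>\<open>A\<close> consists of the reduced words over \<^term>\<open>A\<close>, multiplied by
  concatenation followed by free reduction.
\<close>

type_synonym 'a fword = "('a \<times> bool) list"

definition cancels :: "'a \<times> bool \<Rightarrow> 'a \<times> bool \<Rightarrow> bool" where
  "cancels a b \<longleftrightarrow> fst a = fst b \<and> snd a \<noteq> snd b"

definition reduced :: "'a fword \<Rightarrow> bool" where
  "reduced w \<longleftrightarrow> successively (\<lambda>a b. \<not> cancels a b) w"

fun push :: "'a \<times> bool \<Rightarrow> 'a fword \<Rightarrow> 'a fword" where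
  "push a [] = [a]"
| "push a (b # w) = (if cancels a b then w else a # b # w)"

definition free_group :: "'a set \<Rightarrow> 'a fword monoid" where
  "free_group A =
     \<lparr>carrier = {w. reduced w \<and> fst ` set w \<subseteq> A},
      monoid.mult = (\<lambda>u v. foldr push u v),
      one = []\<rparr>"

definition gen :: "'a \<Rightarrow> 'a fword" where
  "gen x = [(x, True)]"

definition free_of_finite_rank :: "('a, 'b) monoid_scheme \<Rightarrow> bool" where
  "free_of_finite_rank F \<longleftrightarrow> group F \<and> (\<exists>n::nat. F \<cong> free_group {..<n})"

lemma reduced_push: "reduced w \<Longrightarrow> reduced (push a w)"
  by (cases w) (auto simp: reduced_def successively_Cons)

lemma reduced_foldr_push: "reduced v \<Longrightarrow> reduced (foldr push u v)"
  by (induction u) (auto intro: reduced_push)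

lemma foldr_push_reduced: "reduced u \<Longrightarrow> foldr push u [] = u"
proof (induction u)
  case (Cons a u)
  then show ?case
    by (cases u) (auto simp: reduced_def successively_Cons)
qed simp

lemma push_push_cancel:
  assumes "reduced w" "cancels a b"
  shows "push a (push b w) = w"
proof (cases w)
  case (Cons c v)
  show ?thesis
  proof (cases "cancels b c")
    case True
    with assms(2) have "a = c"
      by (auto simp: cancels_def prod_eq_iff)
    with assms Cons True show ?thesis
      by (cases v) (auto simp: reduced_def successively_Cons)
  qed (use assms Cons in auto)
qed (use assms in auto)

lemma foldr_push_push:
  assumes "reduced z"
  shows "foldr push (push a w) z = push a (foldr push w z)"
  using assms by (cases w) (auto simp: push_push_cancel reduced_foldr_push)

lemma foldr_push_assoc:
  "reduced z \<Longrightarrow> foldr push (foldr push u v) z = foldr push u (foldr push v z)"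
  by (induction u) (auto simp: foldr_push_push)

lemma letters_push: "fst ` set (push a w) \<subseteq> insert (fst a) (fst ` set w)"
  by (cases w) auto

lemma letters_foldr_push: "fst ` set (foldr push u v) \<subseteq> fst ` set u \<union> fst ` set v"
proof (induction u)
  case (Cons a u)
  then show ?case
    using letters_push[of a "foldr push u v"] unfolding foldr.simps comp_apply list.set image_insert
    by blast
qed simp

lemma inverse_word:
  "reduced w \<Longrightarrow> foldr push (rev (map (apsnd Not) w)) w = []"
proof (induction w)
  case (Cons a w)
  then have "reduced w"
    by (auto simp: reduced_def successively_Cons)
  moreover have "cancels (apsnd Not a) a"
    by (auto simp: cancels_def apsnd_def)
  ultimately show ?case
    using Cons by simp
qed simp

lemma reduced_inverse_word:
  assumes "reduced w"
  shows "reduced (rev (map (apsnd Not) w))"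
proof -
  have "\<not> cancels (apsnd Not b) (apsnd Not a) \<longleftrightarrow> \<not> cancels a b" for a b :: "'a \<times> bool"
    by (auto simp: cancels_def)
  with assms show ?thesis
    by (simp add: reduced_def successively_map)
qed

lemma group_free_group: "group (free_group A)"
proof (rule groupI)
  fix u v assume "u \<in> carrier (free_group A)" "v \<in> carrier (free_group A)"
  then show "u \<otimes>\<^bsub>free_group A\<^esub> v \<in> carrier (free_group A)"
    using letters_foldr_push[of u v]
    by (simp add: free_group_def reduced_foldr_push) blast
next
  fix u assume u: "u \<in> carrier (free_group A)"
  then have "rev (map (apsnd Not) u) \<in> carrier (free_group A)"
    by (auto simp: free_group_def reduced_inverse_word image_image)
  moreover have "rev (map (apsnd Not) u) \<otimes>\<^bsub>free_group A\<^esub> u = \<one>\<^bsub>free_group A\<^esub>"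
    using u by (simp add: free_group_def inverse_word)
  ultimately show "\<exists>v\<in>carrier (free_group A). v \<otimes>\<^bsub>free_group A\<^esub> u = \<one>\<^bsub>free_group A\<^esub>"
    by blast
qed (auto simp: free_group_def foldr_push_assoc reduced_def)


section \<open>Presentations and two-generator Artin groups\<close>

definition normal_closure :: "('a, 'b) monoid_scheme \<Rightarrow> 'a set \<Rightarrow> 'a set" where
  "normal_closure G R = \<Inter>{N. N \<lhd> G \<and> R \<subseteq> N}"

text \<open>The group \<open>\<langle>A | u = v for (u, v) \<in> R\<rangle>\<close>.\<close>

definition presented_group :: "'a set \<Rightarrow> ('a fword \<times> 'a fword) set \<Rightarrow> 'a fword set monoid" where
  "presented_group A R =
     free_group A Mod normal_closure (free_group A)
       {u \<otimes>\<^bsub>free_group A\<^esub> inv\<^bsub>free_group A\<^esub> v | u v. (u, v) \<in> R}"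

definition artin_word :: "('a, 'b) monoid_scheme \<Rightarrow> nat \<Rightarrow> 'a \<Rightarrow> 'a \<Rightarrow> 'a" where
  "artin_word G m u v =
     (if even m then (u \<otimes>\<^bsub>G\<^esub> v) [^]\<^bsub>G\<^esub> (m div 2)
      else (u \<otimes>\<^bsub>G\<^esub> v) [^]\<^bsub>G\<^esub> (m div 2) \<otimes>\<^bsub>G\<^esub> u)"

datatype artin_gen = Gen_x | Gen_y

definition artin_group :: "nat \<Rightarrow> artin_gen fword set monoid" where
  "artin_group m =
     presented_group {Gen_x, Gen_y}
       {(artin_word (free_group {Gen_x, Gen_y}) m (gen Gen_x) (gen Gen_y),
         artin_word (free_group {Gen_x, Gen_y}) m (gen Gen_y) (gen Gen_x))}"


section \<open>Automorphisms and semidirect products\<close>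

definition inner_automorphism :: "('a, 'b) monoid_scheme \<Rightarrow> ('a \<Rightarrow> 'a) \<Rightarrow> bool" where
  "inner_automorphism G \<psi> \<longleftrightarrow>
     (\<exists>g\<in>carrier G. \<psi> = (\<lambda>x\<in>carrier G. inv\<^bsub>G\<^esub> g \<otimes>\<^bsub>G\<^esub> x \<otimes>\<^bsub>G\<^esub> g))"

definition virtually_inner :: "('a, 'b) monoid_scheme \<Rightarrow> ('a \<Rightarrow> 'a) \<Rightarrow> bool" where
  "virtually_inner G \<phi> \<longleftrightarrow>
     \<phi> \<in> auto G \<and> (\<exists>k::nat. k > 0 \<and> inner_automorphism G (\<phi> [^]\<^bsub>AutoGroup G\<^esub> k))"

text \<open>
  \<open>N \<rtimes> H\<close> for a left action \<^term>\<open>\<theta> \<in> hom H (AutoGroup N)\<close>: with \<^term>\<open>N\<close> and \<^term>\<open>H\<close> embedded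
  in the product, \<open>h n h\<^sup>-\<^sup>1 = \<theta> h n\<close>, so \<open>h\<^sup>-\<^sup>1 n h = \<theta> (h\<^sup>-\<^sup>1) n\<close>.
\<close>

definition semidirect_product ::
  "('a, 'c) monoid_scheme \<Rightarrow> ('b, 'd) monoid_scheme \<Rightarrow> ('b \<Rightarrow> 'a \<Rightarrow> 'a) \<Rightarrow> ('a \<times> 'b) monoid" where
  "semidirect_product N H \<theta> =
     \<lparr>carrier = carrier N \<times> carrier H,
      monoid.mult = (\<lambda>(n, h) (n', h'). (n \<otimes>\<^bsub>N\<^esub> \<theta> h n', h \<otimes>\<^bsub>H\<^esub> h')),
      one = (\<one>\<^bsub>N\<^esub>, \<one>\<^bsub>H\<^esub>)\<rparr>"

lemma group_semidirect_product:
  assumes N: "group N" and H: "group H" and \<theta>: "\<theta> \<in> hom H (AutoGroup N)"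
  shows "group (semidirect_product N H \<theta>)"
proof -
  interpret N: group N by fact
  interpret H: group H by fact
  have aut: "\<theta> h \<in> auto N" if "h \<in> carrier H" for h
    using \<theta> that by (auto simp: hom_def AutoGroup_def)
  then have hom: "\<theta> h \<in> hom N N" if "h \<in> carrier H" for h
    using that by (auto simp: auto_def)
  have closed: "\<theta> h n \<in> carrier N" if "h \<in> carrier H" "n \<in> carrier N" for h n
    using hom that by (auto simp: hom_def)
  have mult: "\<theta> h (a \<otimes>\<^bsub>N\<^esub> b) = \<theta> h a \<otimes>\<^bsub>N\<^esub> \<theta> h b"
    if "h \<in> carrier H" "a \<in> carrier N" "b \<in> carrier N" for h a b
    using hom that by (auto simp: hom_def)
  have comp: "\<theta> (h \<otimes>\<^bsub>H\<^esub> k) n = \<theta> h (\<theta> k n)"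
    if "h \<in> carrier H" "k \<in> carrier H" "n \<in> carrier N" for h k n
    using \<theta> aut[of h] aut[of k] that
    by (auto simp: hom_def AutoGroup_def BijGroup_def auto_def compose_def)
  interpret \<theta>: group_hom H "AutoGroup N" \<theta>
    by (intro group_hom.intro group_hom_axioms.intro H N.AutoGroup \<theta>)
  have one: "\<theta> \<one>\<^bsub>H\<^esub> n = n" if "n \<in> carrier N" for n
    using \<theta>.hom_one that by (simp add: AutoGroup_def BijGroup_def)
  show ?thesis
  proof (rule groupI)
    fix x assume "x \<in> carrier (semidirect_product N H \<theta>)"
    then obtain n h where x: "x = (n, h)" "n \<in> carrier N" "h \<in> carrier H"
      by (auto simp: semidirect_product_def)
    define y where "y = (\<theta> (inv\<^bsub>H\<^esub> h) (inv\<^bsub>N\<^esub> n), inv\<^bsub>H\<^esub> h)"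
    have "\<theta> (inv\<^bsub>H\<^esub> h) (inv\<^bsub>N\<^esub> n) \<otimes>\<^bsub>N\<^esub> \<theta> (inv\<^bsub>H\<^esub> h) n = \<theta> (inv\<^bsub>H\<^esub> h) \<one>\<^bsub>N\<^esub>"
      using x mult[of "inv\<^bsub>H\<^esub> h" "inv\<^bsub>N\<^esub> n" n] by simp
    also have "\<dots> = \<one>\<^bsub>N\<^esub>"
      using x hom[of "inv\<^bsub>H\<^esub> h"] N by (simp add: hom_one)
    finally show "\<exists>y\<in>carrier (semidirect_product N H \<theta>).
        y \<otimes>\<^bsub>semidirect_product N H \<theta>\<^esub> x = \<one>\<^bsub>semidirect_product N H \<theta>\<^esub>"
      using x closed[of "inv\<^bsub>H\<^esub> h" "inv\<^bsub>N\<^esub> n"]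
      by (intro bexI[of _ y]) (auto simp: y_def semidirect_product_def simp del: \<theta>.hom_inv)
  qed (auto simp: semidirect_product_def closed mult comp one N.m_assoc H.m_assoc
      simp del: \<theta>.hom_mult \<theta>.hom_one)
qed

end

theory Submission
  imports Defs
begin

text \<open>
  Put \<open>\<delta> = xy\<close>, \<open>x\<^sub>0 = x\<close> and \<open>x\<^sub>i\<^sub>+\<^sub>1 = x\<^sub>i\<^sup>-\<^sup>1 \<delta>\<close>, so that \<open>x\<^sub>1 = y\<close> and \<open>\<delta>\<close> conjugates \<open>x\<^sub>i\<close> to
  \<open>x\<^sub>i\<^sub>+\<^sub>2\<close>. The Artin relation is equivalent to \<open>x\<^sub>m = x\<^sub>0\<close>, so it makes the sequence periodic and
  \<open>\<delta>\<^sup>m\<close> central. The elements \<open>e\<^sub>i = x\<^sub>i x\<^sup>-\<^sup>1\<close> with \<open>0 < i < m\<close> freely generate the kernel of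
  the map to \<open>\<int>\<close> sending \<open>x\<close> and \<open>y\<close> to \<open>1\<close>, and \<open>x e\<^sub>i x\<^sup>-\<^sup>1 = e\<^sub>i\<^sub>-\<^sub>1\<^sup>-\<^sup>1 e\<^sub>m\<^sub>-\<^sub>1\<close>. Conversely, this
  formula, with \<open>e\<^sub>0 = e\<^sub>m = 1\<close>, defines an automorphism of the free group on
  \<open>e\<^sub>1, \<dots>, e\<^sub>m\<^sub>-\<^sub>1\<close>, and the elements
  \<open>e\<^sub>i x\<close> of the resulting semidirect product satisfy \<open>e\<^sub>i x \<sqdot> e\<^sub>i\<^sub>+\<^sub>1 x = \<delta>\<close>. This yields mutually
  inverse homomorphisms. Since \<open>\<delta>\<^sup>m\<close> is central and lies over \<open>2m\<close>, the automorphism becomes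
  inner after taking its \<open>2m\<close>-th power.
\<close>

section \<open>Homomorphisms out of free and presented groups\<close>

lemma gen_in_free_group [simp]: "gen x \<in> carrier (free_group A) \<longleftrightarrow> x \<in> A"
  by (simp add: free_group_def gen_def reduced_def)

lemma one_free_group: "\<one>\<^bsub>free_group A\<^esub> = []"
  by (simp add: free_group_def)

lemma inv_gen:
  assumes "x \<in> A"
  shows "inv\<^bsub>free_group A\<^esub> gen x = [(x, False)]"
  by (rule group.inv_equality[OF group_free_group])
    (use assms in \<open>auto simp: free_group_def gen_def reduced_def cancels_def\<close>)

text \<open>In a reduced word the first letter cannot cancel, so \<open>push\<close> merely prepends
  it and list \<open>Cons\<close> is a genuine group product. Induction on lists thus becomes
  induction on group elements.\<close>

lemma Cons_in_free_group:
  assumes "a # w \<in> carrier (free_group A)"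
  shows "fst a \<in> A" "w \<in> carrier (free_group A)"
    "a # w = (if snd a then gen (fst a) else inv\<^bsub>free_group A\<^esub> gen (fst a)) \<otimes>\<^bsub>free_group A\<^esub> w"
proof -
  show a: "fst a \<in> A" and "w \<in> carrier (free_group A)"
    using assms by (auto simp: free_group_def reduced_def successively_Cons)
  have "push a w = a # w"
    using assms by (cases w) (auto simp: free_group_def reduced_def)
  moreover have "(if snd a then gen (fst a) else inv\<^bsub>free_group A\<^esub> gen (fst a)) = [a]"
    using a by (cases a; auto simp: inv_gen; simp add: gen_def)
  ultimately show "a # w =
      (if snd a then gen (fst a) else inv\<^bsub>free_group A\<^esub> gen (fst a)) \<otimes>\<^bsub>free_group A\<^esub> w"
    by (simp add: free_group_def)
qed

lemma free_group_hom_eqI: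
  assumes "group G" "h \<in> hom (free_group A) G" "k \<in> hom (free_group A) G"
    and "\<And>x. x \<in> A \<Longrightarrow> h (gen x) = k (gen x)"
    and "w \<in> carrier (free_group A)"
  shows "h w = k w"
proof -
  interpret F: group "free_group A" by (rule group_free_group)
  interpret h: group_hom "free_group A" G h
    using assms by (simp add: group_hom_def group_hom_axioms_def group_free_group)
  interpret k: group_hom "free_group A" G k
    using assms by (simp add: group_hom_def group_hom_axioms_def group_free_group)
  show ?thesis
    using assms(5)
  proof (induction w)
    case Nil
    show ?case
      using h.hom_one k.hom_one by (simp add: one_free_group)
  next
    case (Cons a w)
    note a = Cons_in_free_group[OF Cons.prems]
    have "h w = k w"
      using Cons.IH a by blast
    then show ?case
      using a(1,2) assms(4)[of "fst a"] by (subst (1 2) a(3)) auto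
  qed
qed

text \<open>Evaluates every word, reduced or not, so that compatibility with free reduction can be
  proved one \<open>push\<close> at a time.\<close>

definition free_lift :: "('b, 'c) monoid_scheme \<Rightarrow> ('a \<Rightarrow> 'b) \<Rightarrow> 'a fword \<Rightarrow> 'b" where
  "free_lift G f w =
     foldr (\<lambda>a g. (if snd a then f (fst a) else inv\<^bsub>G\<^esub> f (fst a)) \<otimes>\<^bsub>G\<^esub> g) w \<one>\<^bsub>G\<^esub>"

lemma free_lift_Nil: "free_lift G f [] = \<one>\<^bsub>G\<^esub>"
  by (simp add: free_lift_def)

lemma free_lift_Cons:
  "free_lift G f (a # w) =
     (if snd a then f (fst a) else inv\<^bsub>G\<^esub> f (fst a)) \<otimes>\<^bsub>G\<^esub> free_lift G f w"
  by (simp add: free_lift_def)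

context group
begin

lemma inv_mult_cancel_left:
  assumes "x \<in> carrier G" "y \<in> carrier G"
  shows "inv x \<otimes> (x \<otimes> y) = y" "x \<otimes> (inv x \<otimes> y) = y"
  using assms by (simp_all flip: m_assoc)

lemma commute_inv:
  assumes "a \<otimes> b = b \<otimes> a" "a \<in> carrier G" "b \<in> carrier G"
  shows "inv a \<otimes> b = b \<otimes> inv a"
proof -
  have "b = a \<otimes> (b \<otimes> inv a)"
    using assms by (simp flip: m_assoc) (simp add: m_assoc)
  then show ?thesis
    using assms by (simp add: inv_solve_left')
qed

context
  fixes f :: "'c \<Rightarrow> 'a" and A :: "'c set"
  assumes f: "\<And>x. x \<in> A \<Longrightarrow> f x \<in> carrier G"
begin

lemma free_lift_closed: "fst ` set w \<subseteq> A \<Longrightarrow> free_lift G f w \<in> carrier G"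
  by (induction w) (auto simp: free_lift_Nil free_lift_Cons f)

lemma free_lift_push:
  assumes "fst a \<in> A" "fst ` set w \<subseteq> A"
  shows "free_lift G f (push a w) =
    (if snd a then f (fst a) else inv f (fst a)) \<otimes> free_lift G f w"
proof (cases w)
  case (Cons b v)
  have "free_lift G f v \<in> carrier G" "f (fst a) \<in> carrier G"
    using assms Cons by (auto intro: free_lift_closed f)
  with Cons show ?thesis
    by (auto simp: free_lift_Cons cancels_def inv_mult_cancel_left)
qed (simp add: free_lift_Nil free_lift_Cons)

lemma free_lift_foldr_push:
  assumes "fst ` set u \<subseteq> A" "fst ` set v \<subseteq> A"
  shows "free_lift G f (foldr push u v) = free_lift G f u \<otimes> free_lift G f v"
  using assms(1)
proof (induction u)
  case Nil
  show ?case
    using assms by (simp add: free_lift_Nil free_lift_closed)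
next
  case (Cons a u)
  then have "fst ` set u \<subseteq> A"
    by simp
  with assms(2) have "fst ` set (foldr push u v) \<subseteq> A"
    using letters_foldr_push[of u v] by (meson Un_least order_trans)
  with Cons assms(2) show ?case
    by (auto simp: free_lift_push free_lift_Cons m_assoc free_lift_closed f)
qed

lemma free_lift_hom: "free_lift G f \<in> hom (free_group A) G"
  by (rule homI) (simp_all add: free_group_def free_lift_closed free_lift_foldr_push)

lemma free_lift_gen: "x \<in> A \<Longrightarrow> free_lift G f (gen x) = f x"
  by (simp add: gen_def free_lift_Cons free_lift_Nil f)

end

lemma normal_normal_closure:
  assumes "R \<subseteq> carrier G"
  shows "normal_closure G R \<lhd> G"
proof -
  \<comment> \<open>The whole group belongs to the family, so the intersection is taken over a
    nonempty family.\<close>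
  have "carrier G \<lhd> G"
    by (simp add: normal_inv_iff subgroup_self)
  then have "subgroup (\<Inter>{N. N \<lhd> G \<and> R \<subseteq> N}) G"
    using assms by (intro subgroups_Inter) (auto simp: normal_imp_subgroup)
  then show ?thesis
    unfolding normal_closure_def normal_inv_iff by blast
qed

end

lemma normal_closure_minimal: "N \<lhd> G \<Longrightarrow> R \<subseteq> N \<Longrightarrow> normal_closure G R \<subseteq> N"
  unfolding normal_closure_def by blast

section \<open>Presented groups and their universal property\<close>

locale presentation =
  fixes A :: "'a set" and R :: "('a fword \<times> 'a fword) set"
  assumes relations_closed: "R \<subseteq> carrier (free_group A) \<times> carrier (free_group A)"
begin

abbreviation relators where
  "relators \<equiv> {u \<otimes>\<^bsub>free_group A\<^esub> inv\<^bsub>free_group A\<^esub> v | u v. (u, v) \<in> R}"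

definition proj :: "'a fword \<Rightarrow> 'a fword set" where
  "proj w = normal_closure (free_group A) relators #>\<^bsub>free_group A\<^esub> w"

interpretation F: group "free_group A"
  by (rule group_free_group)

lemma relators_closed: "relators \<subseteq> carrier (free_group A)"
  using relations_closed by auto

interpretation N: normal "normal_closure (free_group A) relators" "free_group A"
  by (rule F.normal_normal_closure[OF relators_closed])

lemma group_presented_group: "group (presented_group A R)"
  unfolding presented_group_def by (rule N.factorgroup_is_group)

lemma proj_hom: "proj \<in> hom (free_group A) (presented_group A R)"
  using N.r_coset_hom_Mod unfolding presented_group_def proj_def .

lemma presented_group_cases:
  assumes "z \<in> carrier (presented_group A R)"
  obtains w where "w \<in> carrier (free_group A)" "z = proj w"
  using assms by (auto simp: presented_group_def FactGroup_def RCOSETS_def proj_def)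

lemma proj_relation:
  assumes "(u, v) \<in> R"
  shows "proj u = proj v"
proof -
  have uv: "u \<in> carrier (free_group A)" "v \<in> carrier (free_group A)"
    using assms relations_closed by auto
  have "u \<otimes>\<^bsub>free_group A\<^esub> inv\<^bsub>free_group A\<^esub> v \<in> normal_closure (free_group A) relators"
    using assms unfolding normal_closure_def by blast
  then have "u \<in> proj v"
    unfolding proj_def using uv by (simp add: N.rcos_module[OF F.is_group])
  then show ?thesis
    using F.repr_independence[OF _ uv(2) N.subgroup_axioms] by (simp add: proj_def)
qed

text \<open>Von Dyck's theorem: the kernel of \<open>h\<close> is normal and contains the relators,
  hence their normal closure, so \<open>h\<close> factors through the quotient.\<close>

lemma presented_group_lift:
  assumes "group H" "h \<in> hom (free_group A) H" "\<And>u v. (u, v) \<in> R \<Longrightarrow> h u = h v"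
  obtains g where "g \<in> hom (presented_group A R) H"
    "\<And>w. w \<in> carrier (free_group A) \<Longrightarrow> g (proj w) = h w"
proof -
  interpret h: group_hom "free_group A" H h
    using assms by (simp add: group_hom_def group_hom_axioms_def group_free_group)
  have "relators \<subseteq> kernel (free_group A) H h"
    using relations_closed assms(3) by (auto simp: kernel_def)
  then have "normal_closure (free_group A) relators \<subseteq> kernel (free_group A) H h"
    by (rule normal_closure_minimal[OF h.normal_kernel])
  then show ?thesis
    by (rule h.FactGroup_universal_kernel[OF N.normal_axioms])
      (rule that, simp_all add: presented_group_def proj_def)
qed

lemma presented_group_hom_eqI:
  assumes "group H" "h \<in> hom (presented_group A R) H" "k \<in> hom (presented_group A R) H"
    and "\<And>x. x \<in> A \<Longrightarrow> h (proj (gen x)) = k (proj (gen x))"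
    and "z \<in> carrier (presented_group A R)"
  shows "h z = k z"
proof -
  obtain w where w: "w \<in> carrier (free_group A)" "z = proj w"
    using assms(5) by (rule presented_group_cases)
  have "(h \<circ> proj) w = (k \<circ> proj) w"
    by (rule free_group_hom_eqI[OF assms(1) hom_compose[OF proj_hom assms(2)]
          hom_compose[OF proj_hom assms(3)] _ w(1)]) (simp add: assms(4))
  with w show ?thesis
    by simp
qed

end

section \<open>Semidirect products\<close>

locale semidirect = N: group N + H: group H + \<theta>: group_hom H "AutoGroup N" \<theta>
  for N :: "('a, 'c) monoid_scheme" and H :: "('b, 'd) monoid_scheme" and \<theta>
begin

abbreviation S where "S \<equiv> semidirect_product N H \<theta>"

sublocale S: group S
  by (rule group_semidirect_product[OF N.is_group H.is_group \<theta>.homh])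

declare \<theta>.hom_one [simp del] \<theta>.hom_mult [simp del] \<theta>.hom_inv [simp del]

lemma carrier_S: "carrier S = carrier N \<times> carrier H"
  and mult_S: "(n, h) \<otimes>\<^bsub>S\<^esub> (n', h') = (n \<otimes>\<^bsub>N\<^esub> \<theta> h n', h \<otimes>\<^bsub>H\<^esub> h')"
  and one_S: "\<one>\<^bsub>S\<^esub> = (\<one>\<^bsub>N\<^esub>, \<one>\<^bsub>H\<^esub>)"
  by (simp_all add: semidirect_product_def)

lemma action_auto: "h \<in> carrier H \<Longrightarrow> \<theta> h \<in> auto N"
  using \<theta>.hom_closed[of h] by (simp add: AutoGroup_def)

lemma action_group_hom: "h \<in> carrier H \<Longrightarrow> group_hom N N (\<theta> h)"
  using action_auto[of h] by (simp add: group_hom_def group_hom_axioms_def auto_def)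

lemma action_closed: "h \<in> carrier H \<Longrightarrow> n \<in> carrier N \<Longrightarrow> \<theta> h n \<in> carrier N"
  by (rule group_hom.hom_closed[OF action_group_hom])

lemma action_fixes_one: "h \<in> carrier H \<Longrightarrow> \<theta> h \<one>\<^bsub>N\<^esub> = \<one>\<^bsub>N\<^esub>"
  by (rule group_hom.hom_one[OF action_group_hom])

lemma action_one: "n \<in> carrier N \<Longrightarrow> \<theta> \<one>\<^bsub>H\<^esub> n = n"
  using \<theta>.hom_one by (simp add: AutoGroup_def BijGroup_def)

lemma action_mult:
  assumes "h \<in> carrier H" "k \<in> carrier H" "n \<in> carrier N"
  shows "\<theta> (h \<otimes>\<^bsub>H\<^esub> k) n = \<theta> h (\<theta> k n)"
  using assms action_auto[of h] action_auto[of k] \<theta>.hom_mult[of h k]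
  by (simp add: AutoGroup_def BijGroup_def auto_def compose_def)

lemma left_factor_hom: "(\<lambda>n. (n, \<one>\<^bsub>H\<^esub>)) \<in> hom N S"
  by (rule homI) (simp_all add: carrier_S mult_S action_one)

lemma right_factor_hom: "(\<lambda>h. (\<one>\<^bsub>N\<^esub>, h)) \<in> hom H S"
  by (rule homI) (simp_all add: carrier_S mult_S action_fixes_one)

lemma snd_hom: "snd \<in> hom S H"
  by (rule homI) (auto simp: carrier_S mult_S)

lemma inv_right_factor: "h \<in> carrier H \<Longrightarrow> inv\<^bsub>S\<^esub> (\<one>\<^bsub>N\<^esub>, h) = (\<one>\<^bsub>N\<^esub>, inv\<^bsub>H\<^esub> h)"
  by (rule S.inv_equality) (simp_all add: carrier_S mult_S one_S action_fixes_one)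

lemma conj_right_factor:
  assumes "h \<in> carrier H" "n \<in> carrier N"
  shows "inv\<^bsub>S\<^esub> (\<one>\<^bsub>N\<^esub>, h) \<otimes>\<^bsub>S\<^esub> (n, \<one>\<^bsub>H\<^esub>) \<otimes>\<^bsub>S\<^esub> (\<one>\<^bsub>N\<^esub>, h) = (\<theta> (inv\<^bsub>H\<^esub> h) n, \<one>\<^bsub>H\<^esub>)"
  using assms
  by (simp add: inv_right_factor mult_S action_closed action_fixes_one)

text \<open>Universal property of the semidirect product. The assumption \<open>ab\<close> says that
  \<open>b h\<close> conjugates \<open>a n\<close> to \<open>a (\<theta> h n)\<close>, written
  without inverses.\<close>

lemma semidirect_lift:
  assumes K: "group K" and a: "a \<in> hom N K" and b: "b \<in> hom H K"
    and ab: "\<And>h n. h \<in> carrier H \<Longrightarrow> n \<in> carrier N \<Longrightarrow> a (\<theta> h n) \<otimes>\<^bsub>K\<^esub> b h = b h \<otimes>\<^bsub>K\<^esub> a n"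
  shows "(\<lambda>(n, h). a n \<otimes>\<^bsub>K\<^esub> b h) \<in> hom S K"
proof -
  interpret K: group K by fact
  interpret a: group_hom N K a
    using a by (simp add: group_hom_def group_hom_axioms_def)
  interpret b: group_hom H K b
    using b by (simp add: group_hom_def group_hom_axioms_def)
  have "a (n \<otimes>\<^bsub>N\<^esub> \<theta> h n') \<otimes>\<^bsub>K\<^esub> b (h \<otimes>\<^bsub>H\<^esub> h') = a n \<otimes>\<^bsub>K\<^esub> b h \<otimes>\<^bsub>K\<^esub> (a n' \<otimes>\<^bsub>K\<^esub> b h')"
    if "n \<in> carrier N" "n' \<in> carrier N" "h \<in> carrier H" "h' \<in> carrier H" for n h n' h'
  proof -
    have "a (n \<otimes>\<^bsub>N\<^esub> \<theta> h n') \<otimes>\<^bsub>K\<^esub> b (h \<otimes>\<^bsub>H\<^esub> h') = a n \<otimes>\<^bsub>K\<^esub> (a (\<theta> h n') \<otimes>\<^bsub>K\<^esub> b h) \<otimes>\<^bsub>K\<^esub> b h'"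
      using that by (simp add: action_closed K.m_assoc)
    also have "\<dots> = a n \<otimes>\<^bsub>K\<^esub> b h \<otimes>\<^bsub>K\<^esub> (a n' \<otimes>\<^bsub>K\<^esub> b h')"
      using that by (simp add: ab K.m_assoc)
    finally show ?thesis .
  qed
  then show ?thesis
    by (intro homI) (auto simp: carrier_S mult_S)
qed

text \<open>Comparing first coordinates gives
  \<open>n \<otimes> c = c \<otimes> \<theta> h n\<close>. This is how a central element over
  \<open>h\<close> will make the action of \<open>h\<close> inner.\<close>

lemma left_factor_commute_conj:
  assumes z: "(c, h) \<in> carrier S" and n: "n \<in> carrier N"
    and comm: "(n, \<one>\<^bsub>H\<^esub>) \<otimes>\<^bsub>S\<^esub> (c, h) = (c, h) \<otimes>\<^bsub>S\<^esub> (n, \<one>\<^bsub>H\<^esub>)"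
  shows "\<theta> h n = inv\<^bsub>N\<^esub> c \<otimes>\<^bsub>N\<^esub> n \<otimes>\<^bsub>N\<^esub> c"
proof -
  have ch: "c \<in> carrier N" "h \<in> carrier H"
    using z by (auto simp: carrier_S)
  have "n \<otimes>\<^bsub>N\<^esub> c = c \<otimes>\<^bsub>N\<^esub> \<theta> h n"
    using comm ch n by (simp add: mult_S action_one)
  then show ?thesis
    using ch n by (simp add: N.m_assoc N.inv_mult_cancel_left action_closed)
qed

end

section \<open>The dihedral sequence\<close>

text \<open>If \<open>x\<close> and \<open>y\<close> are reflections in a dihedral group, the terms
  are the reflections \<open>x\<close>, \<open>y\<close>, \<open>y x y\<close>, and so on. In every
  group two consecutive terms multiply to \<open>x y\<close>.\<close>

fun dihedral_seq :: "('a, 'b) monoid_scheme \<Rightarrow> 'a \<Rightarrow> 'a \<Rightarrow> nat \<Rightarrow> 'a" where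
  "dihedral_seq G x y 0 = x"
| "dihedral_seq G x y (Suc i) = inv\<^bsub>G\<^esub> dihedral_seq G x y i \<otimes>\<^bsub>G\<^esub> (x \<otimes>\<^bsub>G\<^esub> y)"

lemma (in group_hom) hom_dihedral_seq:
  assumes "x \<in> carrier G" "y \<in> carrier G"
  shows "dihedral_seq G x y i \<in> carrier G"
    and "h (dihedral_seq G x y i) = dihedral_seq H (h x) (h y) i"
  using assms by (induction i) auto

lemma (in group_hom) hom_artin_word:
  assumes "x \<in> carrier G" "y \<in> carrier G"
  shows "h (artin_word G m x y) = artin_word H m (h x) (h y)"
  using assms by (simp add: artin_word_def hom_nat_pow)

context group
begin

lemma artin_word_closed:
  "x \<in> carrier G \<Longrightarrow> y \<in> carrier G \<Longrightarrow> artin_word G m x y \<in> carrier G"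
  by (simp add: artin_word_def)

text \<open>Both sides are the alternating word of length \<open>2 * k + 1\<close> that begins with
  \<open>x\<close>.\<close>

lemma mult_pow_swap:
  assumes "x \<in> carrier G" "y \<in> carrier G"
  shows "x \<otimes> (y \<otimes> x) [^] (k::nat) = (x \<otimes> y) [^] k \<otimes> x"
proof (induction k)
  case (Suc k)
  have "x \<otimes> (y \<otimes> x) [^] Suc k = (x \<otimes> (y \<otimes> x) [^] k) \<otimes> (y \<otimes> x)"
    using assms by (simp add: m_assoc)
  also have "\<dots> = (x \<otimes> y) [^] Suc k \<otimes> x"
    unfolding Suc.IH using assms by (simp add: m_assoc)
  finally show ?case .
qed (use assms in simp)

context
  fixes x y
  assumes x: "x \<in> carrier G" and y: "y \<in> carrier G"
begin

private abbreviation "d \<equiv> dihedral_seq G x y"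

lemma dihedral_seq_closed: "d i \<in> carrier G"
  using x y by (induction i) auto

lemma dihedral_seq_1: "d (Suc 0) = y"
  using x y by (simp add: inv_mult_cancel_left)

lemma dihedral_seq_mult_Suc: "d i \<otimes> d (Suc i) = x \<otimes> y"
  using x y dihedral_seq_closed[of i] by (simp add: inv_mult_cancel_left)

text \<open>Bracket the product of three consecutive terms in the two possible ways; either adjacent
  pair equals \<open>x \<otimes> y\<close>.\<close>

lemma dihedral_seq_shift_2: "d i \<otimes> (x \<otimes> y) = x \<otimes> y \<otimes> d (i + 2)"
proof -
  have "d i \<otimes> (x \<otimes> y) = d i \<otimes> (d (Suc i) \<otimes> d (Suc (Suc i)))"
    by (simp only: dihedral_seq_mult_Suc)
  also have "\<dots> = d i \<otimes> d (Suc i) \<otimes> d (Suc (Suc i))"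
    by (simp only: m_assoc dihedral_seq_closed)
  finally show ?thesis
    by (simp only: dihedral_seq_mult_Suc) simp
qed

lemma dihedral_seq_shift: "d i \<otimes> (x \<otimes> y) [^] (k::nat) = (x \<otimes> y) [^] k \<otimes> d (i + 2 * k)"
proof (induction k)
  case 0
  show ?case
    by (simp add: dihedral_seq_closed)
next
  case (Suc k)
  have "d i \<otimes> (x \<otimes> y) [^] Suc k = d i \<otimes> (x \<otimes> y) [^] k \<otimes> (x \<otimes> y)"
    using x y by (simp add: m_assoc dihedral_seq_closed)
  also have "\<dots> = (x \<otimes> y) [^] k \<otimes> (d (i + 2 * k) \<otimes> (x \<otimes> y))"
    using x y by (simp add: Suc.IH m_assoc dihedral_seq_closed)
  also have "\<dots> = (x \<otimes> y) [^] Suc k \<otimes> d (i + 2 * k + 2)"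
    using x y by (simp only: dihedral_seq_shift_2) (simp add: m_assoc dihedral_seq_closed)
  finally show ?case
    by simp
qed

text \<open>A power \<open>(x \<otimes> y) [^] k\<close> moves left past a term by raising its index
  by \<open>2 * k\<close>; once this power is cancelled, the relation compares \<open>d m\<close>
  with \<open>x\<close>. Valid in any group, it serves both the Artin group and the semidirect
  product.\<close>

lemma artin_word_swap_iff: "artin_word G m x y = artin_word G m y x \<longleftrightarrow> d m = x"
proof (cases "even m")
  case True
  then obtain k where m: "m = 2 * k" ..
  \<comment> \<open>Multiplying by \<open>x = d 0\<close> on the left supplies a term for the power
    to move past.\<close>
  have "artin_word G m x y = artin_word G m y x \<longleftrightarrow>
      x \<otimes> (x \<otimes> y) [^] k = x \<otimes> (y \<otimes> x) [^] k"
    using x y by (simp add: artin_word_def m)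
  also have "\<dots> \<longleftrightarrow> (x \<otimes> y) [^] k \<otimes> d m = (x \<otimes> y) [^] k \<otimes> x"
    using dihedral_seq_shift[of 0 k] x y by (simp add: mult_pow_swap m)
  finally show ?thesis
    using x y by (simp add: dihedral_seq_closed)
next
  case False
  then obtain k where m: "m = Suc (2 * k)"
    using oddE by fastforce
  \<comment> \<open>For odd \<open>m\<close> the word beginning with \<open>y\<close> already
    supplies the term \<open>y = d 1\<close>, whose index rises to
    \<open>1 + 2 * k = m\<close>.\<close>
  have "(y \<otimes> x) [^] k \<otimes> y = y \<otimes> (x \<otimes> y) [^] k"
    using x y by (simp add: mult_pow_swap)
  also have "\<dots> = (x \<otimes> y) [^] k \<otimes> d m"
    using dihedral_seq_shift[of "Suc 0" k] unfolding dihedral_seq_1 by (simp add: m)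
  finally have "artin_word G m x y = artin_word G m y x \<longleftrightarrow>
      (x \<otimes> y) [^] k \<otimes> x = (x \<otimes> y) [^] k \<otimes> d m"
    by (simp add: artin_word_def m)
  then show ?thesis
    using x y l_cancel[of "(x \<otimes> y) [^] k" x "d m"] dihedral_seq_closed[of m] by auto
qed

context
  fixes m :: nat
  assumes period: "d m = x"
begin

text \<open>Each term determines the next, so one return to \<open>x\<close> makes the sequence
  repeat. Multiples of \<open>m\<close> are covered because moving past
  \<open>(x \<otimes> y) [^] m\<close> raises the index by two periods.\<close>

lemma dihedral_seq_period: "d (i + k * m) = d i"
proof -
  have "d (i + m) = d i" for i
    using period by (induction i) auto
  from this[of "i + k * m" for k] show ?thesis
    by (induction k) (simp_all add: algebra_simps)
qed

lemma dihedral_seq_commute: "d i \<otimes> (x \<otimes> y) [^] m = (x \<otimes> y) [^] m \<otimes> d i"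
  by (simp only: dihedral_seq_shift dihedral_seq_period)

text \<open>From \<open>d (m - 1) \<otimes> d m = x \<otimes> y\<close> and \<open>d m = x\<close>,
  the last term before the return is \<open>x \<otimes> y \<otimes> inv x\<close>; both sides then
  equal \<open>x \<otimes> inv (d i) \<otimes> (x \<otimes> y) \<otimes> inv x\<close>. The
  definition of \<open>\<sigma>\<close> copies this identity.\<close>

lemma dihedral_seq_conj:
  assumes "i < m"
  shows "x \<otimes> (d (Suc i) \<otimes> inv x) = inv (d i \<otimes> inv x) \<otimes> (d (m - 1) \<otimes> inv x) \<otimes> x"
proof -
  have "d (m - 1) \<otimes> x = x \<otimes> y"
    using dihedral_seq_mult_Suc[of "m - 1"] assms period by (simp del: dihedral_seq.simps)
  then have "d (m - 1) = x \<otimes> y \<otimes> inv x"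
    using x y dihedral_seq_closed[of "m - 1"] by (metis inv_solve_right m_closed)
  then show ?thesis
    using x y dihedral_seq_closed[of i] by (simp add: inv_mult_group m_assoc)
qed

end

end

end

section \<open>The monodromy automorphism\<close>

text \<open>Members of \<open>auto G\<close> must be undefined outside the carrier, hence the
  \<open>restrict\<close>; the inverse homomorphism witnesses bijectivity.\<close>

lemma (in group) restrict_in_auto:
  assumes "\<sigma> \<in> hom G G" "\<tau> \<in> hom G G"
    and "\<And>g. g \<in> carrier G \<Longrightarrow> \<tau> (\<sigma> g) = g" "\<And>g. g \<in> carrier G \<Longrightarrow> \<sigma> (\<tau> g) = g"
  shows "restrict \<sigma> (carrier G) \<in> auto G"
proof -
  have "bij_betw \<sigma> (carrier G) (carrier G)"
    by (rule bij_betw_byWitness[where f' = \<tau>]) (use assms in \<open>auto simp: hom_def\<close>)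
  then have "restrict \<sigma> (carrier G) \<in> Bij (carrier G)"
    by (simp add: Bij_def)
  moreover have "restrict \<sigma> (carrier G) \<in> hom G G"
    using assms(1) by (auto simp: hom_def)
  ultimately show ?thesis
    by (simp add: auto_def)
qed

section \<open>The free fibre, its monodromy and the inverse of the monodromy\<close>

locale artin_fibre =
  fixes m :: nat
  assumes m: "m \<ge> 2"
begin

definition F :: "nat fword monoid" where "F = free_group {..<m - 1}"

sublocale F: group F
  by (simp add: F_def group_free_group)

text \<open>The trivial values at \<open>0\<close> and \<open>m\<close> stand for the end terms
  \<open>x\<close> of the sequence divided by \<open>x\<close>; they let the formulas below run
  across both ends.\<close>

definition e :: "nat \<Rightarrow> nat fword" where
  "e i = (if i = 0 \<or> i \<ge> m then \<one>\<^bsub>F\<^esub> else gen (i - 1))"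

lemma e_0: "e 0 = \<one>\<^bsub>F\<^esub>" and e_m: "e m = \<one>\<^bsub>F\<^esub>"
  by (simp_all add: e_def)

lemma gen_eq_e: "j \<in> {..<m - 1} \<Longrightarrow> gen j = e (Suc j)"
  by (auto simp: e_def)

lemma e_closed [simp]: "e i \<in> carrier F"
  using m by (auto simp: e_def) (simp add: F_def less_diff_conv)

lemma F_hom_eqI:
  assumes "group G" "h \<in> hom F G" "k \<in> hom F G"
    and "\<And>i. Suc i < m \<Longrightarrow> h (e (Suc i)) = k (e (Suc i))" and "w \<in> carrier F"
  shows "h w = k w"
  by (rule free_group_hom_eqI[OF assms(1-3)[unfolded F_def] _ assms(5)[unfolded F_def]])
    (use assms(4) in \<open>simp add: gen_eq_e less_diff_conv\<close>)

definition lift :: "('b, 'c) monoid_scheme \<Rightarrow> (nat \<Rightarrow> 'b) \<Rightarrow> nat fword \<Rightarrow> 'b" where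
  "lift G f = free_lift G (\<lambda>j. f (Suc j))"

text \<open>Freeness gives the evaluation for \<open>0 < i < m\<close>; the boundary assumptions on
  \<open>f\<close> extend it to both ends, where \<open>e i\<close> is trivial.\<close>

lemma lift:
  assumes "group G" "\<And>i. f i \<in> carrier G" "f 0 = \<one>\<^bsub>G\<^esub>" "f m = \<one>\<^bsub>G\<^esub>"
  shows "group_hom F G (lift G f)"
    and "i \<le> m \<Longrightarrow> lift G f (e i) = f i"
proof -
  interpret G: group G by fact
  have "lift G f \<in> hom F G"
    unfolding lift_def F_def by (rule G.free_lift_hom) (rule assms)
  then show hom: "group_hom F G (lift G f)"
    by (simp add: group_hom_def group_hom_axioms_def F.is_group)
  assume "i \<le> m"
  then consider "i = 0" | "i = m" | j where "i = Suc j" "j < m - 1"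
    using m by (cases i; cases "i = m") auto
  then show "lift G f (e i) = f i"
  proof cases
    case 3
    then show ?thesis
      using G.free_lift_gen[of "{..<m - 1}" "\<lambda>j. f (Suc j)" j] assms(2)
      by (simp add: lift_def flip: gen_eq_e)
  qed (use group_hom.hom_one[OF hom] assms in \<open>simp_all add: e_0 e_m\<close>)
qed

text \<open>Models conjugation by \<open>x\<close>. The value at \<open>0\<close> is given
  separately because \<open>i - 1\<close> truncates there and the formula would yield
  \<open>e (m - 1)\<close>; at \<open>m\<close> the formula is trivial by itself.\<close>

definition \<sigma> :: "nat fword \<Rightarrow> nat fword" where
  "\<sigma> = lift F (\<lambda>i. if i = 0 then \<one>\<^bsub>F\<^esub> else inv\<^bsub>F\<^esub> e (i - 1) \<otimes>\<^bsub>F\<^esub> e (m - 1))"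

text \<open>Found by solving the formula for \<open>\<sigma> (e (Suc i))\<close> for
  \<open>e i\<close>, using \<open>\<sigma> (e 1) = e (m - 1)\<close>. Now \<open>0\<close> is the
  automatic end and \<open>m\<close> the one with a prescribed value.\<close>

definition \<tau> :: "nat fword \<Rightarrow> nat fword" where
  "\<tau> = lift F (\<lambda>i. if i \<ge> m then \<one>\<^bsub>F\<^esub> else e 1 \<otimes>\<^bsub>F\<^esub> inv\<^bsub>F\<^esub> e (Suc i))"

sublocale \<sigma>: group_hom F F \<sigma>
  unfolding \<sigma>_def by (rule lift) (use m F.is_group in \<open>auto simp: e_m\<close>)

sublocale \<tau>: group_hom F F \<tau>
  unfolding \<tau>_def by (rule lift) (use m F.is_group in auto)

lemma \<sigma>_e: "i < m \<Longrightarrow> \<sigma> (e (Suc i)) = inv\<^bsub>F\<^esub> e i \<otimes>\<^bsub>F\<^esub> e (m - 1)"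
  unfolding \<sigma>_def by (subst lift(2)) (use m F.is_group in auto)

lemma \<tau>_e: "i < m \<Longrightarrow> \<tau> (e i) = e 1 \<otimes>\<^bsub>F\<^esub> inv\<^bsub>F\<^esub> e (Suc i)"
  unfolding \<tau>_def by (subst lift(2)) (use m F.is_group in auto)

lemma \<tau>_\<sigma>:
  assumes "w \<in> carrier F"
  shows "\<tau> (\<sigma> w) = w"
proof -
  have "\<tau> (\<sigma> (e (Suc i))) = e (Suc i)" if "Suc i < m" for i
    using that m by (simp add: \<sigma>_e \<tau>_e e_m F.inv_mult_group F.m_assoc)
  then have "(\<tau> \<circ> \<sigma>) w = id w"
    by (intro F_hom_eqI[OF F.is_group hom_compose[OF \<sigma>.homh \<tau>.homh] _ _ assms])
      (auto simp: hom_def)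
  then show ?thesis
    by simp
qed

lemma \<sigma>_\<tau>:
  assumes "w \<in> carrier F"
  shows "\<sigma> (\<tau> w) = w"
proof -
  have "\<sigma> (\<tau> (e (Suc i))) = e (Suc i)" if "Suc i < m" for i
    using that m \<sigma>_e[of 0]
    by (simp add: \<sigma>_e \<tau>_e e_0 F.inv_mult_group F.inv_mult_cancel_left)
  then have "(\<sigma> \<circ> \<tau>) w = id w"
    by (intro F_hom_eqI[OF F.is_group hom_compose[OF \<tau>.homh \<sigma>.homh] _ _ assms])
      (auto simp: hom_def)
  then show ?thesis
    by simp
qed

lemma \<sigma>_auto: "restrict \<sigma> (carrier F) \<in> carrier (AutoGroup F)"
  using F.restrict_in_auto[OF \<sigma>.homh \<tau>.homh \<tau>_\<sigma> \<sigma>_\<tau>] by (simp add: AutoGroup_def)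

definition \<theta> :: "int \<Rightarrow> nat fword \<Rightarrow> nat fword" where
  "\<theta> k = restrict \<sigma> (carrier F) [^]\<^bsub>AutoGroup F\<^esub> k"

lemma \<theta>_hom: "\<theta> \<in> hom integer_group (AutoGroup F)"
  using group.hom_integer_group_pow[OF F.AutoGroup \<sigma>_auto] by (simp add: \<theta>_def[abs_def])

lemma \<theta>_1: "w \<in> carrier F \<Longrightarrow> \<theta> 1 w = \<sigma> w"
  using group.int_pow_1[OF F.AutoGroup \<sigma>_auto] by (simp add: \<theta>_def)

sublocale semidirect F integer_group \<theta>
  by (intro semidirect.intro group_hom.intro group_hom_axioms.intro
      F.is_group F.AutoGroup group_integer_group \<theta>_hom)

lemmas \<theta>_0 = action_one[simplified]
  and \<theta>_add = action_mult[simplified]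

section \<open>The dihedral sequence inside the semidirect product\<close>

definition x\<^sub>S where "x\<^sub>S = (\<one>\<^bsub>F\<^esub>, 1 :: int)"

definition y\<^sub>S where "y\<^sub>S = (e 1, 1 :: int)"

lemma x_S_closed [simp]: "x\<^sub>S \<in> carrier S" and y_S_closed [simp]: "y\<^sub>S \<in> carrier S"
  by (simp_all add: carrier_S x\<^sub>S_def y\<^sub>S_def)

lemma dihedral_seq_S: "i \<le> m \<Longrightarrow> dihedral_seq S x\<^sub>S y\<^sub>S i = (e i, 1)"
proof (induction i)
  case 0
  show ?case
    by (simp add: x\<^sub>S_def e_0)
next
  case (Suc i)
  \<comment> \<open>The first coordinate is \<open>e i \<otimes> \<sigma> (e (Suc i))\<close>, which
    does not depend on \<open>i\<close>; the case \<open>i = 0\<close> identifies the product as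
    that of \<open>x\<^sub>S\<close> and \<open>y\<^sub>S\<close>.\<close>
  have "(e i, 1) \<otimes>\<^bsub>S\<^esub> (e (Suc i), 1) = (e (m - 1), 2)"
    using Suc.prems by (simp add: mult_S \<theta>_1 \<sigma>_e F.inv_mult_cancel_left)
  also have "\<dots> = x\<^sub>S \<otimes>\<^bsub>S\<^esub> y\<^sub>S"
    using m \<sigma>_e[of 0] by (simp add: x\<^sub>S_def y\<^sub>S_def mult_S \<theta>_1 e_0)
  finally have "inv\<^bsub>S\<^esub> (e i, 1) \<otimes>\<^bsub>S\<^esub> (x\<^sub>S \<otimes>\<^bsub>S\<^esub> y\<^sub>S) = (e (Suc i), 1)"
    by (subst S.inv_solve_left') (simp_all, simp_all add: carrier_S)
  with Suc show ?case
    by simp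
qed

lemma dihedral_period: "dihedral_seq S x\<^sub>S y\<^sub>S m = x\<^sub>S"
  using dihedral_seq_S[of m] by (simp add: x\<^sub>S_def e_m)

lemma left_factor_eq: "w \<in> carrier F \<Longrightarrow> (w, 0) = (w, 1) \<otimes>\<^bsub>S\<^esub> inv\<^bsub>S\<^esub> x\<^sub>S"
  using inv_right_factor[of 1] by (simp add: x\<^sub>S_def mult_S action_fixes_one)

lemma x_S_int_pow: "x\<^sub>S [^]\<^bsub>S\<^esub> (k :: int) = (\<one>\<^bsub>F\<^esub>, k)"
proof -
  interpret r: group_hom integer_group S "\<lambda>h. (\<one>\<^bsub>F\<^esub>, h)"
    using right_factor_hom by (simp add: group_hom_def group_hom_axioms_def S.is_group)
  show ?thesis
    using r.hom_int_pow[of 1 k] by (simp add: x\<^sub>S_def)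
qed

lemma virtually_inner_monodromy: "virtually_inner F (\<theta> (-1))"
proof -
  \<comment> \<open>The inverse puts \<open>z\<close> over \<open>- 2 * int m\<close>, so that it
    matches the power \<open>2 * m\<close> of \<open>\<theta> (-1)\<close>.\<close>
  define z where "z = inv\<^bsub>S\<^esub> ((x\<^sub>S \<otimes>\<^bsub>S\<^esub> y\<^sub>S) [^]\<^bsub>S\<^esub> m)"
  define c where "c = fst z"
  interpret s: group_hom S integer_group snd
    using snd_hom by (simp add: group_hom_def group_hom_axioms_def S.is_group)
  have z: "z \<in> carrier S"
    by (simp add: z_def)
  have "snd z = - 2 * int m"
    by (simp add: z_def s.hom_nat_pow) (simp add: x\<^sub>S_def y\<^sub>S_def)
  then have z_eq: "z = (c, - 2 * int m)"
    by (simp add: c_def prod_eq_iff)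
  have c: "c \<in> carrier F"
    using z by (simp add: z_eq carrier_S)
  have seq: "dihedral_seq S x\<^sub>S y\<^sub>S i \<otimes>\<^bsub>S\<^esub> z = z \<otimes>\<^bsub>S\<^esub> dihedral_seq S x\<^sub>S y\<^sub>S i" for i
  proof -
    have "(x\<^sub>S \<otimes>\<^bsub>S\<^esub> y\<^sub>S) [^]\<^bsub>S\<^esub> m \<otimes>\<^bsub>S\<^esub> dihedral_seq S x\<^sub>S y\<^sub>S i =
        dihedral_seq S x\<^sub>S y\<^sub>S i \<otimes>\<^bsub>S\<^esub> (x\<^sub>S \<otimes>\<^bsub>S\<^esub> y\<^sub>S) [^]\<^bsub>S\<^esub> m"
      by (simp add: S.dihedral_seq_commute dihedral_period)
    then show ?thesis
      unfolding z_def using S.commute_inv S.dihedral_seq_closed by simp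
  qed
  \<comment> \<open>Both sides are homomorphisms, so generators suffice. Each
    \<open>(e (Suc i), 0)\<close> is a term of the sequence times the inverse of
    \<open>x\<^sub>S\<close>, and \<open>z\<close> commutes with both factors.\<close>
  have eq: "\<theta> (- 2 * int m) w = inv\<^bsub>F\<^esub> c \<otimes>\<^bsub>F\<^esub> w \<otimes>\<^bsub>F\<^esub> c" if "w \<in> carrier F" for w
  proof (rule F_hom_eqI[OF F.is_group _ _ _ that])
    show "\<theta> (- 2 * int m) \<in> hom F F"
      by (rule group_hom.homh[OF action_group_hom]) simp
    show "(\<lambda>w. inv\<^bsub>F\<^esub> c \<otimes>\<^bsub>F\<^esub> w \<otimes>\<^bsub>F\<^esub> c) \<in> hom F F"
      using c by (intro homI) (simp_all add: F.m_assoc F.inv_mult_cancel_left)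
    fix i assume i: "Suc i < m"
    have "(e (Suc i), 0) \<otimes>\<^bsub>S\<^esub> z = z \<otimes>\<^bsub>S\<^esub> (e (Suc i), 0)"
    proof -
      have d: "dihedral_seq S x\<^sub>S y\<^sub>S (Suc i) \<in> carrier S"
        by (rule S.dihedral_seq_closed) simp_all
      have "(e (Suc i), 0) = dihedral_seq S x\<^sub>S y\<^sub>S (Suc i) \<otimes>\<^bsub>S\<^esub> inv\<^bsub>S\<^esub> x\<^sub>S"
        using i by (simp add: dihedral_seq_S left_factor_eq del: dihedral_seq.simps)
      moreover have "inv\<^bsub>S\<^esub> x\<^sub>S \<otimes>\<^bsub>S\<^esub> z = z \<otimes>\<^bsub>S\<^esub> inv\<^bsub>S\<^esub> x\<^sub>S"
        using seq[of 0] z by (simp add: S.commute_inv)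
      ultimately show ?thesis
        using seq[of "Suc i"] z d
        by (simp add: S.m_assoc del: dihedral_seq.simps) (simp flip: S.m_assoc del: dihedral_seq.simps)
    qed
    then show "\<theta> (- 2 * int m) (e (Suc i)) = inv\<^bsub>F\<^esub> c \<otimes>\<^bsub>F\<^esub> e (Suc i) \<otimes>\<^bsub>F\<^esub> c"
      using z left_factor_commute_conj[of c "- 2 * int m" "e (Suc i)"] by (simp add: z_eq)
  qed
  have "\<theta> (-1) [^]\<^bsub>AutoGroup F\<^esub> (2 * m) = \<theta> (- 2 * int m)"
    using \<theta>.hom_nat_pow[of "-1" "2 * m"] by simp
  \<comment> \<open>Agreement on the carrier becomes equality of functions because both sides are
    undefined elsewhere.\<close>
  moreover have "\<theta> (- 2 * int m) \<in> extensional (carrier F)"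
    using action_auto[of "- 2 * int m"] by (simp add: auto_def Bij_def)
  ultimately have "inner_automorphism F (\<theta> (-1) [^]\<^bsub>AutoGroup F\<^esub> (2 * m))"
    unfolding inner_automorphism_def using c eq
    by (intro bexI[of _ c]) (auto simp: extensional_def fun_eq_iff)
  then show ?thesis
    unfolding virtually_inner_def using action_auto[of "-1"] m by (auto intro!: exI[of _ "2 * m"])
qed

section \<open>The isomorphism\<close>

definition relation where
  "relation =
     (artin_word (free_group {Gen_x, Gen_y}) m (gen Gen_x) (gen Gen_y),
      artin_word (free_group {Gen_x, Gen_y}) m (gen Gen_y) (gen Gen_x))"

sublocale presentation "{Gen_x, Gen_y}" "{relation}"
  by unfold_locales
    (simp add: relation_def group.artin_word_closed group_free_group)

abbreviation A where "A \<equiv> artin_group m"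

lemma A_eq: "A = presented_group {Gen_x, Gen_y} {relation}"
  by (simp add: artin_group_def relation_def)

sublocale A: group A
  unfolding A_eq by (rule group_presented_group)

definition x\<^sub>A where "x\<^sub>A = proj (gen Gen_x)"

definition y\<^sub>A where "y\<^sub>A = proj (gen Gen_y)"

sublocale proj: group_hom "free_group {Gen_x, Gen_y}" A proj
  using proj_hom A.is_group
  by (simp add: group_hom_def group_hom_axioms_def group_free_group A_eq)

lemma x_A_closed [simp]: "x\<^sub>A \<in> carrier A" and y_A_closed [simp]: "y\<^sub>A \<in> carrier A"
  by (simp_all add: x\<^sub>A_def y\<^sub>A_def)

lemma dihedral_seq_A: "dihedral_seq A x\<^sub>A y\<^sub>A m = x\<^sub>A"
proof -
  have "proj (fst relation) = proj (snd relation)"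
    by (rule proj_relation) simp
  moreover have "fst relation = artin_word (free_group {Gen_x, Gen_y}) m (gen Gen_x) (gen Gen_y)"
    and "snd relation = artin_word (free_group {Gen_x, Gen_y}) m (gen Gen_y) (gen Gen_x)"
    by (simp_all add: relation_def)
  ultimately have "artin_word A m x\<^sub>A y\<^sub>A = artin_word A m y\<^sub>A x\<^sub>A"
    by (simp add: proj.hom_artin_word x\<^sub>A_def y\<^sub>A_def)
  then show ?thesis
    by (simp add: A.artin_word_swap_iff)
qed

text \<open>Since \<open>e m\<close> is trivial, the sequence in \<open>S\<close> returns to
  \<open>x\<^sub>S\<close> after \<open>m\<close> steps; by \<open>artin_word_swap_iff\<close> this
  is the defining relation.\<close>

lemma to_semidirect:
  obtains h where "group_hom A S h" "h x\<^sub>A = x\<^sub>S" "h y\<^sub>A = y\<^sub>S"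
proof -
  define f where "f g = (case g of Gen_x \<Rightarrow> x\<^sub>S | Gen_y \<Rightarrow> y\<^sub>S)" for g
  have f: "f g \<in> carrier S" for g
    by (cases g) (simp_all add: f_def)
  interpret f: group_hom "free_group {Gen_x, Gen_y}" S "free_lift S f"
    using S.free_lift_hom[of "{Gen_x, Gen_y}" f] f
    by (simp add: group_hom_def group_hom_axioms_def group_free_group S.is_group)
  have gens: "free_lift S f (gen Gen_x) = x\<^sub>S" "free_lift S f (gen Gen_y) = y\<^sub>S"
    using S.free_lift_gen[of "{Gen_x, Gen_y}" f] f by (simp_all add: f_def)
  have "artin_word S m x\<^sub>S y\<^sub>S = artin_word S m y\<^sub>S x\<^sub>S"
    by (simp add: S.artin_word_swap_iff dihedral_period)
  then have eq: "free_lift S f u = free_lift S f v" if "(u, v) \<in> {relation}" for u v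
    using that by (simp add: relation_def f.hom_artin_word gens)
  obtain h where h: "h \<in> hom A S"
    "\<And>w. w \<in> carrier (free_group {Gen_x, Gen_y}) \<Longrightarrow> h (proj w) = free_lift S f w"
    using presented_group_lift[OF S.is_group f.homh eq] unfolding A_eq by blast
  show ?thesis
    by (rule that[of h])
      (use h gens in \<open>simp_all add: group_hom_def group_hom_axioms_def S.is_group A.is_group x\<^sub>A_def y\<^sub>A_def\<close>)
qed

section \<open>The homomorphism from the semidirect product back to the Artin group\<close>

definition fibre_lift :: "nat fword \<Rightarrow> artin_gen fword set" where
  "fibre_lift = lift A (\<lambda>i. dihedral_seq A x\<^sub>A y\<^sub>A i \<otimes>\<^bsub>A\<^esub> inv\<^bsub>A\<^esub> x\<^sub>A)"

text \<open>The required triviality at \<open>i = m\<close> is the Artin relation in the form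
  \<open>dihedral_seq_A\<close>.\<close>

sublocale fibre: group_hom F A fibre_lift
  unfolding fibre_lift_def
  by (rule lift) (simp_all add: A.is_group A.dihedral_seq_closed dihedral_seq_A)

lemma fibre_lift_e: "i \<le> m \<Longrightarrow> fibre_lift (e i) = dihedral_seq A x\<^sub>A y\<^sub>A i \<otimes>\<^bsub>A\<^esub> inv\<^bsub>A\<^esub> x\<^sub>A"
  unfolding fibre_lift_def
  by (rule lift) (simp_all add: A.is_group A.dihedral_seq_closed dihedral_seq_A)

lemma fibre_lift_\<sigma>:
  assumes "w \<in> carrier F"
  shows "fibre_lift (\<sigma> w) \<otimes>\<^bsub>A\<^esub> x\<^sub>A = x\<^sub>A \<otimes>\<^bsub>A\<^esub> fibre_lift w"
proof -
  \<comment> \<open>In this conjugated form both sides are homomorphisms in \<open>w\<close>, and on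
    generators the claim is \<open>dihedral_seq_conj\<close>.\<close>
  have "(fibre_lift \<circ> \<sigma>) w = x\<^sub>A \<otimes>\<^bsub>A\<^esub> fibre_lift w \<otimes>\<^bsub>A\<^esub> inv\<^bsub>A\<^esub> x\<^sub>A"
  proof (rule F_hom_eqI[OF A.is_group hom_compose[OF \<sigma>.homh fibre.homh] _ _ assms])
    show "(\<lambda>w. x\<^sub>A \<otimes>\<^bsub>A\<^esub> fibre_lift w \<otimes>\<^bsub>A\<^esub> inv\<^bsub>A\<^esub> x\<^sub>A) \<in> hom F A"
      by (rule homI) (simp_all add: A.m_assoc A.inv_mult_cancel_left)
    fix i assume i: "Suc i < m"
    have "x\<^sub>A \<otimes>\<^bsub>A\<^esub> fibre_lift (e (Suc i)) =
        inv\<^bsub>A\<^esub> fibre_lift (e i) \<otimes>\<^bsub>A\<^esub> fibre_lift (e (m - 1)) \<otimes>\<^bsub>A\<^esub> x\<^sub>A"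
      using A.dihedral_seq_conj[OF x_A_closed y_A_closed dihedral_seq_A, of i] i
      by (simp add: fibre_lift_e del: dihedral_seq.simps)
    also have "\<dots> = fibre_lift (\<sigma> (e (Suc i))) \<otimes>\<^bsub>A\<^esub> x\<^sub>A"
      using i by (simp add: \<sigma>_e)
    finally show "(fibre_lift \<circ> \<sigma>) (e (Suc i)) = x\<^sub>A \<otimes>\<^bsub>A\<^esub> fibre_lift (e (Suc i)) \<otimes>\<^bsub>A\<^esub> inv\<^bsub>A\<^esub> x\<^sub>A"
      by (simp add: A.m_assoc)
  qed
  then show ?thesis
    using assms by (simp add: A.m_assoc)
qed

lemma fibre_lift_\<theta>:
  assumes "w \<in> carrier F"
  shows "fibre_lift (\<theta> k w) \<otimes>\<^bsub>A\<^esub> x\<^sub>A [^]\<^bsub>A\<^esub> k = x\<^sub>A [^]\<^bsub>A\<^esub> k \<otimes>\<^bsub>A\<^esub> fibre_lift w"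
  using assms
proof (induction k arbitrary: w rule: int_induct[where k = 0])
  case base
  then show ?case
    by (simp add: \<theta>_0)
next
  case (step1 k)
  have "\<theta> (k + 1) w = \<theta> k (\<sigma> w)"
    using \<theta>_add[of w k 1] step1.prems by (simp add: \<theta>_1)
  moreover have pow: "x\<^sub>A [^]\<^bsub>A\<^esub> (k + 1) = x\<^sub>A [^]\<^bsub>A\<^esub> k \<otimes>\<^bsub>A\<^esub> x\<^sub>A"
    using A.int_pow_mult[of x\<^sub>A k 1] by (simp add: A.int_pow_1)
  ultimately have "fibre_lift (\<theta> (k + 1) w) \<otimes>\<^bsub>A\<^esub> x\<^sub>A [^]\<^bsub>A\<^esub> (k + 1) =
      (fibre_lift (\<theta> k (\<sigma> w)) \<otimes>\<^bsub>A\<^esub> x\<^sub>A [^]\<^bsub>A\<^esub> k) \<otimes>\<^bsub>A\<^esub> x\<^sub>A"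
    using step1.prems by (simp add: A.m_assoc action_closed)
  also have "\<dots> = x\<^sub>A [^]\<^bsub>A\<^esub> k \<otimes>\<^bsub>A\<^esub> (fibre_lift (\<sigma> w) \<otimes>\<^bsub>A\<^esub> x\<^sub>A)"
    using step1 by (simp add: A.m_assoc)
  also have "\<dots> = x\<^sub>A [^]\<^bsub>A\<^esub> (k + 1) \<otimes>\<^bsub>A\<^esub> fibre_lift w"
    using step1.prems pow by (simp add: fibre_lift_\<sigma> A.m_assoc)
  finally show ?case .
next
  case (step2 k)
  \<comment> \<open>To descend, write \<open>w = \<sigma> v\<close>: then
    \<open>\<theta> (k - 1) w = \<theta> k v\<close>, the induction hypothesis applies to
    \<open>v\<close>, and a factor \<open>x\<^sub>A\<close> on the right is cancelled at the
    end.\<close>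
  define v where "v = \<tau> w"
  have v: "v \<in> carrier F" "\<sigma> v = w"
    using step2.prems by (simp_all add: v_def \<sigma>_\<tau>)
  have \<theta>: "\<theta> (k - 1) w = \<theta> k v"
    using \<theta>_add[of v "k - 1" 1] v by (simp add: \<theta>_1)
  have pow: "x\<^sub>A [^]\<^bsub>A\<^esub> k = x\<^sub>A [^]\<^bsub>A\<^esub> (k - 1) \<otimes>\<^bsub>A\<^esub> x\<^sub>A"
    using A.int_pow_mult[of x\<^sub>A "k - 1" 1] by (simp add: A.int_pow_1)
  have "fibre_lift (\<theta> (k - 1) w) \<otimes>\<^bsub>A\<^esub> x\<^sub>A [^]\<^bsub>A\<^esub> (k - 1) \<otimes>\<^bsub>A\<^esub> x\<^sub>A =
      fibre_lift (\<theta> k v) \<otimes>\<^bsub>A\<^esub> x\<^sub>A [^]\<^bsub>A\<^esub> k"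
    using v by (simp add: \<theta> pow A.m_assoc action_closed)
  also have "\<dots> = x\<^sub>A [^]\<^bsub>A\<^esub> (k - 1) \<otimes>\<^bsub>A\<^esub> (x\<^sub>A \<otimes>\<^bsub>A\<^esub> fibre_lift v)"
    using step2.IH[OF v(1)] v by (simp add: pow A.m_assoc)
  also have "\<dots> = x\<^sub>A [^]\<^bsub>A\<^esub> (k - 1) \<otimes>\<^bsub>A\<^esub> fibre_lift w \<otimes>\<^bsub>A\<^esub> x\<^sub>A"
    using fibre_lift_\<sigma>[OF v(1)] v step2.prems by (simp add: A.m_assoc)
  finally show ?case
    using step2.prems by (simp add: action_closed)
qed

definition from_semidirect :: "nat fword \<times> int \<Rightarrow> artin_gen fword set" where
  "from_semidirect = (\<lambda>(w, k). fibre_lift w \<otimes>\<^bsub>A\<^esub> x\<^sub>A [^]\<^bsub>A\<^esub> k)"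

lemma from_semidirect_hom: "from_semidirect \<in> hom S A"
  unfolding from_semidirect_def
  by (rule semidirect_lift)
    (simp_all add: A.is_group fibre.homh A.hom_integer_group_pow fibre_lift_\<theta>)

lemma artin_group_iso_semidirect: "A \<cong> S"
proof -
  obtain h where h: "group_hom A S h" "h x\<^sub>A = x\<^sub>S" "h y\<^sub>A = y\<^sub>S"
    by (rule to_semidirect)
  interpret h: group_hom A S h by fact
  have "(from_semidirect \<circ> h) a = id a" if "a \<in> carrier A" for a
  proof (rule presented_group_hom_eqI[folded A_eq, OF A.is_group
        hom_compose[OF h.homh from_semidirect_hom] _ _ that])
    show "id \<in> hom A A"
      by (auto simp: hom_def)
    have "from_semidirect x\<^sub>S = x\<^sub>A"
      by (simp add: from_semidirect_def x\<^sub>S_def A.int_pow_1)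
    moreover have "from_semidirect y\<^sub>S = y\<^sub>A"
      using fibre_lift_e[of 1] m
      by (simp add: from_semidirect_def y\<^sub>S_def A.int_pow_1 A.m_assoc A.inv_mult_cancel_left)
    ultimately show "(from_semidirect \<circ> h) (proj (gen g)) = id (proj (gen g))"
      if "g \<in> {Gen_x, Gen_y}" for g
      using that h by (auto simp flip: x\<^sub>A_def y\<^sub>A_def)
  qed
  moreover have "h (from_semidirect (w, k)) = (w, k)" if "w \<in> carrier F" for w k
  proof -
    \<comment> \<open>On generators, \<open>e i\<close> goes to a term of the sequence in
      \<open>A\<close> times the inverse of \<open>x\<^sub>A\<close>, and \<open>h\<close> carries
      this to \<open>(e i, 1)\<close> times the inverse of \<open>x\<^sub>S\<close>.\<close>
    have "(h \<circ> fibre_lift) w = (w, 0)"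
    proof (rule F_hom_eqI[OF S.is_group hom_compose[OF fibre.homh h.homh] _ _ that])
      show "(\<lambda>w. (w, 0)) \<in> hom F S"
        using left_factor_hom by simp
      fix i assume "Suc i < m"
      then show "(h \<circ> fibre_lift) (e (Suc i)) = (e (Suc i), 0)"
        by (simp add: fibre_lift_e h.hom_dihedral_seq h dihedral_seq_S left_factor_eq
            del: dihedral_seq.simps)
    qed
    then show ?thesis
      using that by (simp add: from_semidirect_def h.hom_int_pow h x_S_int_pow mult_S
          \<theta>_0 action_fixes_one)
  qed
  ultimately have "group_isomorphisms A S h from_semidirect"
    using h.homh from_semidirect_hom by (auto simp: group_isomorphisms_def carrier_S)
  then show ?thesis
    using group_isomorphisms_imp_iso is_isoI by blast
qed

end

lemma integer_group_generated_by_1: "subgroup_generated integer_group {1} = integer_group"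
  by (rule monoid.equality)
    (auto simp: subgroup_generated_def group.generate_pow)

theorem proposition2p1:
  fixes m :: nat
  assumes "m \<ge> 3"
  shows "\<exists>(F :: nat fword monoid) (T :: int monoid) \<theta> t \<phi>.
    free_of_finite_rank F \<and>
    group T \<and> t \<in> carrier T \<and> subgroup_generated T {t} = T \<and>
    \<theta> \<in> hom T (AutoGroup F) \<and>
    artin_group m \<cong> semidirect_product F T \<theta> \<and>
    virtually_inner F \<phi> \<and>
    (\<forall>f\<in>carrier F.
       inv\<^bsub>semidirect_product F T \<theta>\<^esub> (\<one>\<^bsub>F\<^esub>, t)
         \<otimes>\<^bsub>semidirect_product F T \<theta>\<^esub> (f, \<one>\<^bsub>T\<^esub>)
         \<otimes>\<^bsub>semidirect_product F T \<theta>\<^esub> (\<one>\<^bsub>F\<^esub>, t)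
       = (\<phi> f, \<one>\<^bsub>T\<^esub>))"
proof -
  interpret artin_fibre m
    using assms by unfold_locales simp
  have "F \<cong> free_group {..<m - 1}"
    by (simp add: F_def iso_refl)
  then have "free_of_finite_rank F"
    unfolding free_of_finite_rank_def using F.is_group by blast
  \<comment> \<open>The generator is \<open>t = 1\<close>, and by \<open>conj_right_factor\<close>
    the map \<open>f \<mapsto> inv t \<otimes> f \<otimes> t\<close> is the action of
    \<open>inv t\<close>, so \<open>\<phi>\<close> is \<open>\<theta> (-1)\<close>.\<close>
  then show ?thesis
    using integer_group_generated_by_1 \<theta>_hom artin_group_iso_semidirect
      virtually_inner_monodromy conj_right_factor[of 1, simplified]
    by (intro exI[of _ F] exI[of _ integer_group] exI[of _ \<theta>] exI[of _ 1] exI[of _ "\<theta> (-1)"])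
      simp
qed

end
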